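(* Let $x > 2$. Then $$\sum_{n \leq x} M^2(n) = B_2\, x + O(x^{1/2}),$$ where $$B_2 = B_1 + 2 \sum_{k=2}^{\infty} (k - 1) \left( 1 - \frac{1}{\zeta(k)} \right) \approx 4.301302400, \qquad B_1 = 1 + \sum_{k=2}^\infty \left( 1 - \frac{1}{\zeta(k)} \right).$$
   Context: For a natural number $n > 1$ with prime factorization $n = p_1^{\alpha_1} \cdots p_r^{\alpha_r}$ (distinct primes $p_i$, exponents $\alpha_i \geq 1$), $M(n) = \max\{\alpha_1, \ldots, \alpha_r\}$ is the maximum exponent of any prime power dividing $n$; by convention $M(1) = 1$. $\zeta$ denotes the Riemann zeta function. *)

theory Defs
  imports "HOL-Analysis.Analysis" "HOL-Computational_Algebra.Primes"
begin

(* Junk value at n = 0, where prime_factors is empty; only n >= 1 is used. *)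
definition max_exponent :: "nat \<Rightarrow> nat" where
  "max_exponent n = (if n = 1 then 1 else Max ((\<lambda>p. multiplicity p n) ` prime_factors n))"

(* The Dirichlet series, hence the Riemann zeta function only on the real half-line s > 1. *)
definition zeta :: "real \<Rightarrow> real" where
  "zeta s = (\<Sum>n. 1 / real (Suc n) powr s)"

(* In the two constants the summation index k of the series is shifted: the library's series
   start at 0, so the term with index k here is the one for the exponent k + 2. *)
definition B1 :: real where
  "B1 = 1 + (\<Sum>k. 1 - 1 / zeta (real (k + 2)))"

definition B2 :: real where
  "B2 = B1 + 2 * (\<Sum>k. (real (k + 2) - 1) * (1 - 1 / zeta (real (k + 2))))"

end

theory Submission
  imports Defs "HOL-Computational_Algebra.Squarefree" "HOL-Computational_Algebra.Nth_Powers"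
    "HOL-Real_Asymp.Real_Asymp"
begin

text \<open>Since \<open>M\<^sup>2 = 1 + (\<Sum>k = 2..M. 2k - 1)\<close>, the sum equals \<open>\<lfloor>x\<rfloor> + (\<Sum>k\<ge>2. (2k - 1) A\<^sub>k(x))\<close>, where
  \<open>A\<^sub>k(x)\<close> counts the \<open>n \<le> x\<close> that are not \<open>k\<close>-free. Moebius inversion gives
  \<open>A\<^sub>k(x) = x (1 - 1/\<zeta>(k)) + O(x powr (1/k))\<close> uniformly in \<open>k\<close>. For \<open>2 ^ k > x\<close> the count vanishes and
  \<open>1 - 1/\<zeta>(k) \<le> 4 / 2 ^ k\<close>; in both ranges the error is at most \<open>12 \<surd>x q ^ k\<close> with
  \<open>q = 2 powr (-1/6) < 1\<close>, which can be summed against \<open>2k - 1\<close>. The numerical value comes from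
  the Euler--Maclaurin expansion of \<open>\<zeta>(k)\<close> for \<open>k \<le> 45\<close> in integer fixed-point arithmetic.\<close>

section \<open>Euler--Maclaurin bounds for zeta\<close>

text \<open>Monotonicity on the unit interval. Iterating it carries the sign of a third derivative
  down to the function itself.\<close>

lemma nonneg_if_derivative_nonneg:
  fixes p p' :: "real \<Rightarrow> real"
  assumes "p 0 = 0" "\<And>u. 0 \<le> u \<Longrightarrow> u \<le> 1 \<Longrightarrow> (p has_real_derivative p' u) (at u)"
    "\<And>u. 0 \<le> u \<Longrightarrow> u \<le> 1 \<Longrightarrow> 0 \<le> p' u"
    and u: "0 \<le> u" "u \<le> 1"
  shows "0 \<le> p u"
proof -
  have "p 0 \<le> p u"
    by (rule DERIV_nonneg_imp_nondecreasing) (use assms in \<open>auto intro: order_trans[of _ u 1]\<close>)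
  with assms(1) show ?thesis by simp
qed

text \<open>As a function of the step length \<open>u\<close>, the error and its first two derivatives vanish at
  \<open>u = 0\<close>, and its third derivative is \<open>u\<^sup>2 f\<^sub>4(a + u) / 12\<close>.\<close>

lemma corrected_trapezoid:
  fixes F f f1 f2 f3 f4 :: "real \<Rightarrow> real"
  assumes
      "\<And>y. a \<le> y \<Longrightarrow> y \<le> a + 1 \<Longrightarrow> (F has_real_derivative f y) (at y)"
      "\<And>y. a \<le> y \<Longrightarrow> y \<le> a + 1 \<Longrightarrow> (f has_real_derivative f1 y) (at y)"
      "\<And>y. a \<le> y \<Longrightarrow> y \<le> a + 1 \<Longrightarrow> (f1 has_real_derivative f2 y) (at y)"
      "\<And>y. a \<le> y \<Longrightarrow> y \<le> a + 1 \<Longrightarrow> (f2 has_real_derivative f3 y) (at y)"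
      "\<And>y. a \<le> y \<Longrightarrow> y \<le> a + 1 \<Longrightarrow> (f3 has_real_derivative f4 y) (at y)"
      "\<And>y. a \<le> y \<Longrightarrow> y \<le> a + 1 \<Longrightarrow> 0 \<le> f4 y"
      "\<And>y. a \<le> y \<Longrightarrow> y \<le> a + 1 \<Longrightarrow> f4 y \<le> c"
  defines "R \<equiv> F (a + 1) - F a - (f a + f (a + 1)) / 2 + (f1 (a + 1) - f1 a) / 12"
  shows "0 \<le> R" "R \<le> c / 720"
proof -
  have D: "((\<lambda>u. g (a + u)) has_real_derivative g' (a + u)) (at u)"
    if "\<And>y. a \<le> y \<Longrightarrow> y \<le> a + 1 \<Longrightarrow> (g has_real_derivative g' y) (at y)" "0 \<le> u" "u \<le> 1" for g g' u
  proof -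
    have "(g has_real_derivative g' (a + u)) (at (u + a))"
      using that(1)[of "a + u"] that(2,3) by (simp add: add.commute)
    then have "((\<lambda>u. g (u + a)) has_real_derivative g' (a + u)) (at u)"
      by (simp only: DERIV_shift)
    then show ?thesis by (simp add: add.commute)
  qed
  note D = D[OF assms(1)] D[OF assms(2)] D[OF assms(3)] D[OF assms(4)] D[OF assms(5)]
  define p where "p u = F (a + u) - F a - u * (f a + f (a + u)) / 2 + u^2 * (f1 (a + u) - f1 a) / 12" for u
  define p1 where "p1 u = f (a + u) - (f a + f (a + u)) / 2 - u * f1 (a + u) / 2
    + u * (f1 (a + u) - f1 a) / 6 + u^2 * f2 (a + u) / 12" for u
  define p2 where "p2 u = (f1 (a + u) - f1 a) / 6 - u * f2 (a + u) / 6 + u^2 * f3 (a + u) / 12" for u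
  define p3 where "p3 u = u^2 * f4 (a + u) / 12" for u
  have Dp: "(p has_real_derivative p1 u) (at u)" "(p1 has_real_derivative p2 u) (at u)"
    "(p2 has_real_derivative p3 u) (at u)" if "0 \<le> u" "u \<le> 1" for u
    unfolding p_def p1_def p2_def p3_def
    by (rule derivative_eq_intros D that refl | simp add: field_simps power2_eq_square)+
  have z: "p 0 = 0" "p1 0 = 0" "p2 0 = 0" by (simp_all add: p_def p1_def p2_def)
  have nn3: "0 \<le> p3 u" if "0 \<le> u" "u \<le> 1" for u
    using that assms(6)[of "a + u"] by (simp add: p3_def)
  have nn2: "0 \<le> p2 u" if "0 \<le> u" "u \<le> 1" for u
    by (rule nonneg_if_derivative_nonneg[OF z(3) Dp(3) nn3]) (use that in auto)
  have nn1: "0 \<le> p1 u" if "0 \<le> u" "u \<le> 1" for u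
    by (rule nonneg_if_derivative_nonneg[OF z(2) Dp(2) nn2]) (use that in auto)
  have "0 \<le> p 1"
    by (rule nonneg_if_derivative_nonneg[OF z(1) Dp(1) nn1]) auto
  then show "0 \<le> R" by (simp add: p_def R_def)
  \<comment> \<open>For the upper bound the same climb starts from \<open>c * u^2 / 12\<close>. Its
    successive antiderivatives vanishing at 0 have the denominators 36, 144 and 720.\<close>
  have m3: "0 \<le> c * u^2 / 12 - p3 u" if "0 \<le> u" "u \<le> 1" for u
    using that mult_left_mono[OF assms(7)[of "a + u"], of "u^2"] by (simp add: p3_def mult.commute)
  have m2: "0 \<le> c * u^3 / 36 - p2 u" if u: "0 \<le> u" "u \<le> 1" for u
    by (rule nonneg_if_derivative_nonneg[OF _ _ m3 u])
      (use z in \<open>auto intro!: derivative_eq_intros Dp\<close>)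
  have m1: "0 \<le> c * u^4 / 144 - p1 u" if u: "0 \<le> u" "u \<le> 1" for u
    by (rule nonneg_if_derivative_nonneg[OF _ _ m2 u])
      (use z in \<open>auto intro!: derivative_eq_intros Dp\<close>)
  have "0 \<le> c * 1^5 / 720 - p 1"
    by (rule nonneg_if_derivative_nonneg[OF _ _ m1])
      (use z in \<open>auto intro!: derivative_eq_intros Dp\<close>)
  then show "R \<le> c / 720" by (simp add: p_def R_def)
qed



section \<open>Two-sided bounds for tails of the zeta series\<close>

lemma powr_has_derivative:
  assumes "0 < (y::real)"
  shows "((\<lambda>x. c * x powr r) has_real_derivative c * r * y powr (r - 1)) (at y)"
  using assms by (auto intro!: derivative_eq_intros)

text \<open>The Euler--Maclaurin expansion of the tail \<open>\<Sum>n. (x + n) powr - s\<close> up to the Bernoulli number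
  \<open>B\<^sub>2\<close>, and the modulus of its \<open>B\<^sub>4\<close> term at \<open>x - 1\<close>, which bounds the error.\<close>

definition zeta_tail :: "real \<Rightarrow> real \<Rightarrow> real" where
  "zeta_tail s x = x powr (1 - s) / (s - 1) + x powr (- s) / 2 + s * x powr (- s - 1) / 12"

definition zeta_tail_err :: "real \<Rightarrow> real \<Rightarrow> real" where
  "zeta_tail_err s x = s * (s + 1) * (s + 2) * (x - 1) powr (- s - 3) / 720"

text \<open>This is the corrected trapezoid rule for \<open>y powr (- s)\<close> on the interval
  from \<open>a\<close> to \<open>a + 1\<close>. Its defect is at most \<open>f4 a / 720\<close>,
  and that bound is in turn dominated by a telescoping difference, so both inequalities can be
  summed over \<open>a\<close>.\<close>

lemma zeta_tail_step:
  assumes "1 < s" "1 < a"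
  shows "a powr (- s) \<le> zeta_tail s a - zeta_tail s (a + 1)"
    and "zeta_tail s a - zeta_tail s (a + 1) - (zeta_tail_err s a - zeta_tail_err s (a + 1)) \<le> a powr (- s)"
proof -
  define F where "F x = 1 / (1 - s) * x powr (1 - s)" for x
  define f where "f x = x powr (- s)" for x :: real
  define f1 where "f1 x = - s * x powr (- s - 1)" for x
  define f2 where "f2 x = s * (s + 1) * x powr (- s - 2)" for x
  define f3 where "f3 x = - s * (s + 1) * (s + 2) * x powr (- s - 3)" for x
  define f4 where "f4 x = s * (s + 1) * (s + 2) * (s + 3) * x powr (- s - 4)" for x
  have D: "(F has_real_derivative f y) (at y)" "(f has_real_derivative f1 y) (at y)"
    "(f1 has_real_derivative f2 y) (at y)" "(f2 has_real_derivative f3 y) (at y)"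
    "(f3 has_real_derivative f4 y) (at y)" if "0 < y" for y
    using that powr_has_derivative[OF that, of "1 / (1 - s)" "1 - s"] powr_has_derivative[OF that, of 1 "- s"]
      powr_has_derivative[OF that, of "- s" "- s - 1"] powr_has_derivative[OF that, of "s * (s + 1)" "- s - 2"]
      powr_has_derivative[OF that, of "- s * (s + 1) * (s + 2)" "- s - 3"] assms(1)
    unfolding F_def f_def f1_def f2_def f3_def f4_def by (simp_all add: algebra_simps)
  have mono: "f4 z \<le> f4 y" if "0 < y" "y \<le> z" for y z
    using that assms(1) unfolding f4_def by (intro mult_left_mono powr_mono2') auto
  have nonneg: "0 \<le> f4 y" for y
    using assms(1) by (simp add: f4_def)
  let ?R = "F (a + 1) - F a - (f a + f (a + 1)) / 2 + (f1 (a + 1) - f1 a) / 12"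
  have R: "0 \<le> ?R" "?R \<le> f4 a / 720"
    using assms(2) by (auto intro!: corrected_trapezoid[of a F f f1 f2 f3 f4 "f4 a"] D mono nonneg simp del: le_divide_eq_numeral1)
  have R_eq: "?R = zeta_tail s a - zeta_tail s (a + 1) - a powr (- s)"
  proof -
    have "F x = - (x powr (1 - s) / (s - 1))" for x
      by (simp add: F_def minus_divide_right)
    then show ?thesis
      by (simp add: f_def f1_def zeta_tail_def diff_divide_distrib add_divide_distrib)
  qed
  with R(1) show "a powr (- s) \<le> zeta_tail s a - zeta_tail s (a + 1)" by simp
  \<comment> \<open>As \<open>f4\<close> decreases, \<open>f4 a\<close> is at most the increment of
    \<open>f3\<close> over the preceding unit interval. This is why \<open>zeta_tail_err\<close> is
    evaluated at \<open>x - 1\<close>.\<close>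
  obtain z where z: "a - 1 < z" "z < a" "f3 a - f3 (a - 1) = (a - (a - 1)) * f4 z"
    using MVT2[of "a - 1" a f3 f4] D assms(2) by auto
  have "f4 a \<le> f3 a - f3 (a - 1)"
    using z mono[of z a] assms(2) by simp
  also have "\<dots> = 720 * (zeta_tail_err s a - zeta_tail_err s (a + 1))"
    by (simp add: f3_def zeta_tail_err_def algebra_simps)
  finally show "zeta_tail s a - zeta_tail s (a + 1) - (zeta_tail_err s a - zeta_tail_err s (a + 1)) \<le> a powr (- s)"
    using R(2) R_eq by simp
qed

lemma suminf_le_telescope:
  fixes f g :: "nat \<Rightarrow> real"
  assumes "summable f" "\<And>i. f i \<le> g i - g (Suc i)" "g \<longlonglongrightarrow> 0"
  shows "suminf f \<le> g 0"
  using sums_le[OF assms(2) summable_sums[OF assms(1)] telescope_sums'[OF assms(3)]] by simp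

lemma suminf_ge_telescope:
  fixes f g :: "nat \<Rightarrow> real"
  assumes "summable f" "\<And>i. g i - g (Suc i) \<le> f i" "g \<longlonglongrightarrow> 0"
  shows "g 0 \<le> suminf f"
  using sums_le[OF assms(2) telescope_sums'[OF assms(3)] summable_sums[OF assms(1)]] by simp

lemma filterlim_add_real_at_top: "filterlim (\<lambda>i. c + real i) at_top sequentially"
  by (rule filterlim_tendsto_add_at_top[OF tendsto_const filterlim_real_sequentially])

lemma zeta_tail_tendsto_0:
  assumes "1 < s"
  shows "(\<lambda>i. zeta_tail s (c + real i)) \<longlonglongrightarrow> 0"
    and "(\<lambda>i. zeta_tail_err s (c + real i)) \<longlonglongrightarrow> 0"
proof -
  have *: "(\<lambda>i. (c + real i) powr r) \<longlonglongrightarrow> 0" if "r < 0" for r c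
    by (rule tendsto_neg_powr[OF that filterlim_add_real_at_top])
  show "(\<lambda>i. zeta_tail s (c + real i)) \<longlonglongrightarrow> 0"
    unfolding zeta_tail_def by (rule tendsto_eq_intros * | use assms in simp)+
  have "(\<lambda>i. s * (s + 1) * (s + 2) * ((c - 1) + real i) powr (- s - 3) / 720) \<longlonglongrightarrow> 0"
    by (rule tendsto_eq_intros * | use assms in simp)+
  then show "(\<lambda>i. zeta_tail_err s (c + real i)) \<longlonglongrightarrow> 0"
    unfolding zeta_tail_err_def by (simp add: algebra_simps)
qed

lemma zeta_summable:
  assumes "1 < s"
  shows "summable (\<lambda>n. 1 / real (Suc n) powr s)"
proof -
  have "summable (\<lambda>n. real (Suc n) powr (- s))"
    using assms by (subst summable_Suc_iff) (simp add: summable_real_powr_iff)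
  then show ?thesis by (simp add: powr_minus field_simps)
qed

text \<open>The first \<open>N\<close> terms are kept and the step inequalities are telescoped over
  the rest. The tail starts at \<open>Suc N\<close>, so the error term is taken at the positive
  point \<open>N\<close>.\<close>

lemma zeta_bounds:
  assumes s: "1 < s" and N: "1 \<le> N"
  defines "H \<equiv> (\<Sum>n<N. 1 / real (Suc n) powr s) + zeta_tail s (real (Suc N))"
  shows "zeta s \<le> H" "H - zeta_tail_err s (real (Suc N)) \<le> zeta s"
proof -
  define f where "f i = (real (Suc N) + real i) powr (- s)" for i
  have f: "1 / real (Suc (i + N)) powr s = f i" for i
    by (simp add: f_def powr_minus field_simps)
  have sf: "summable f"
    using summable_ignore_initial_segment[OF zeta_summable[OF s], of N] by (simp only: f)
  have z: "zeta s = suminf f + (\<Sum>n<N. 1 / real (Suc n) powr s)"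
    unfolding zeta_def using suminf_split_initial_segment[OF zeta_summable[OF s], of N] by (simp only: f)
  have *: "real (Suc N) + real (Suc i) = real (Suc N) + real i + 1" for i by simp
  note st = zeta_tail_step[OF s, of "real (Suc N) + real i" for i]
  have "suminf f \<le> zeta_tail s (real (Suc N) + real 0)"
  proof (rule suminf_le_telescope[OF sf])
    show "f i \<le> zeta_tail s (real (Suc N) + real i) - zeta_tail s (real (Suc N) + real (Suc i))" for i
      using st(1)[of i] N unfolding * f_def by simp
  qed (rule zeta_tail_tendsto_0[OF s])
  moreover have "zeta_tail s (real (Suc N) + real 0) - zeta_tail_err s (real (Suc N) + real 0) \<le> suminf f"
  proof (rule suminf_ge_telescope[OF sf])
    show "(\<lambda>i. zeta_tail s (real (Suc N) + real i) - zeta_tail_err s (real (Suc N) + real i)) \<longlonglongrightarrow> 0"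
      using tendsto_diff[OF zeta_tail_tendsto_0[OF s, of "real (Suc N)"]] by simp
    show "zeta_tail s (real (Suc N) + real i) - zeta_tail_err s (real (Suc N) + real i) -
        (zeta_tail s (real (Suc N) + real (Suc i)) - zeta_tail_err s (real (Suc N) + real (Suc i))) \<le> f i" for i
      using st(2)[of i] N unfolding * f_def by (simp add: algebra_simps)
  qed
  ultimately show "zeta s \<le> H" "H - zeta_tail_err s (real (Suc N)) \<le> zeta s"
    by (simp_all add: z H_def)
qed

section \<open>Integer fixed-point evaluation of zeta\<close>

lemma real_of_int_div_bounds:
  assumes "0 < b"
  shows "real_of_int (a div b) \<le> real_of_int a / real_of_int b"
    "real_of_int a / real_of_int b \<le> real_of_int (a div b) + 1"
  using floor_correct[of "real_of_int a / real_of_int b"] unfolding floor_divide_of_int_eq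
  by linarith+

lemma zeta_ge_1:
  assumes "1 < s"
  shows "1 \<le> zeta s"
  unfolding zeta_def
  using sum_le_suminf[OF zeta_summable[OF assms], of "{0}"] by simp

lemma power_minus_nat_powr:
  assumes "0 < (x::real)"
  shows "x powr (- real k) = 1 / x ^ k"
  using assms by (simp add: powr_minus powr_realpow field_simps)

lemma zeta_tail_nat:
  assumes "0 < x" "2 \<le> k"
  shows "zeta_tail (real k) x = 1 / (real (k - 1) * x ^ (k - 1)) + 1 / (2 * x ^ k) + real k / (12 * x ^ (k + 1))"
proof -
  have e: "1 - real k = - real (k - 1)" "real k - 1 = real (k - 1)" "- real k - 1 = - real (k + 1)"
    using assms(2) by auto
  show ?thesis
    unfolding zeta_tail_def e power_minus_nat_powr[OF assms(1)] by (simp add: ac_simps)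
qed

lemma zeta_tail_err_nat:
  assumes "1 < x"
  shows "zeta_tail_err (real k) x = real k * (real k + 1) * (real k + 2) / (720 * (x - 1) ^ (k + 3))"
proof -
  have e: "- real k - 3 = - real (k + 3)" by simp
  show ?thesis
    unfolding zeta_tail_err_def e using assms by (subst power_minus_nat_powr) (simp_all add: field_simps)
qed

text \<open>The upper bound of \<open>zeta_bounds\<close> scaled by \<open>S\<close>, with each of
  its \<open>N + 3\<close> summands rounded down separately. The list sum suits evaluation by
  \<open>code_simp\<close>.\<close>

definition zeta_fixed :: "int \<Rightarrow> nat \<Rightarrow> nat \<Rightarrow> int" where
  "zeta_fixed S N k = (\<Sum>n\<leftarrow>[0..<N]. S div int (Suc n) ^ k) + S div (int (k - 1) * int (Suc N) ^ (k - 1))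
     + S div (2 * int (Suc N) ^ k) + S * int k div (12 * int (Suc N) ^ (k + 1))"

definition zeta_fixed_err :: "int \<Rightarrow> nat \<Rightarrow> nat \<Rightarrow> int" where
  "zeta_fixed_err S N k = S * (int k * (int k + 1) * (int k + 2)) div (720 * int N ^ (k + 3))"

text \<open>Each rounded division loses at most 1, which costs \<open>N + 3\<close> above. Below,
  rounding the main terms is harmless and only the subtracted error term costs 1.\<close>

lemma zeta_fixed_bounds:
  assumes "2 \<le> k" "1 \<le> N" "0 \<le> S"
  shows "real_of_int S * zeta (real k) \<le> real_of_int (zeta_fixed S N k) + real N + 3"
    and "real_of_int (zeta_fixed S N k) - real_of_int (zeta_fixed_err S N k) - 1 \<le> real_of_int S * zeta (real k)"
proof -
  define T where "T = real_of_int S * (\<Sum>n<N. 1 / real (Suc n) powr real k)"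
  have T: "T = (\<Sum>n<N. real_of_int S / real_of_int (int (Suc n) ^ k))"
    unfolding T_def sum_distrib_left by (intro sum.cong) (simp_all add: powr_realpow)
  have l: "(\<Sum>n\<leftarrow>[0..<N]. S div int (Suc n) ^ k) = (\<Sum>n<N. S div int (Suc n) ^ k)"
    by (simp add: interv_sum_list_conv_sum_set_nat atLeast0LessThan)
  have T1: "real_of_int (\<Sum>n<N. S div int (Suc n) ^ k) \<le> T"
    unfolding T of_int_sum by (intro sum_mono real_of_int_div_bounds) simp
  have "T \<le> (\<Sum>n<N. real_of_int (S div int (Suc n) ^ k) + 1)"
    unfolding T by (intro sum_mono real_of_int_div_bounds) simp
  then have T2: "T \<le> real_of_int (\<Sum>n<N. S div int (Suc n) ^ k) + real N"
    by (simp add: sum.distrib)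
  define b1 b2 b3 b4 where b: "b1 = int (k - 1) * int (Suc N) ^ (k - 1)" "b2 = 2 * int (Suc N) ^ k"
    "b3 = 12 * int (Suc N) ^ (k + 1)" "b4 = 720 * int N ^ (k + 3)"
  have pos: "0 < b1" "0 < b2" "0 < b3" "0 < b4"
    using assms by (auto simp: b)
  have t: "real_of_int S * zeta_tail (real k) (real (Suc N)) =
      real_of_int S / real_of_int b1 + real_of_int S / real_of_int b2 + real_of_int (S * int k) / real_of_int b3"
    using assms(1) by (subst zeta_tail_nat) (simp_all add: b distrib_left)
  have e: "real_of_int S * zeta_tail_err (real k) (real (Suc N)) = real_of_int (S * (int k * (int k + 1) * (int k + 2))) / real_of_int b4"
    using assms(2) by (subst zeta_tail_err_nat) (simp_all add: b)
  note dv = real_of_int_div_bounds[OF pos(1), of S] real_of_int_div_bounds[OF pos(2), of S]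
    real_of_int_div_bounds[OF pos(3), of "S * int k"]
    real_of_int_div_bounds[OF pos(4), of "S * (int k * (int k + 1) * (int k + 2))"]
  have k: "1 < real k" using assms(1) by simp
  note z = zeta_bounds[OF k assms(2)]
  have S: "0 \<le> real_of_int S" using assms(3) by simp
  have "real_of_int S * zeta (real k) \<le> T + real_of_int S * zeta_tail (real k) (real (Suc N))"
    using mult_left_mono[OF z(1) S] by (simp only: T_def distrib_left)
  then show "real_of_int S * zeta (real k) \<le> real_of_int (zeta_fixed S N k) + real N + 3"
    unfolding zeta_fixed_def l t using T2 dv by (simp add: b)
  have "T + real_of_int S * zeta_tail (real k) (real (Suc N)) - real_of_int S * zeta_tail_err (real k) (real (Suc N)) \<le> real_of_int S * zeta (real k)"
    using mult_left_mono[OF z(2) S] by (simp only: T_def distrib_left right_diff_distrib)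
  then show "real_of_int (zeta_fixed S N k) - real_of_int (zeta_fixed_err S N k) - 1 \<le> real_of_int S * zeta (real k)"
    unfolding zeta_fixed_def zeta_fixed_err_def l t e using T1 dv by (simp add: b)
qed

definition coeff_upper :: "int \<Rightarrow> nat \<Rightarrow> nat \<Rightarrow> int" where
  "coeff_upper S N k = S - S * S div (zeta_fixed S N k + int N + 3)"

text \<open>Since zeta is at least 1, \<open>S\<close> itself bounds
  \<open>S * zeta (real k)\<close> from below; the \<open>max\<close> thus stays valid and keeps the
  divisor positive. The subtracted 1 pays for rounding the quotient down.\<close>

definition coeff_lower :: "int \<Rightarrow> nat \<Rightarrow> nat \<Rightarrow> int" where
  "coeff_lower S N k = S - 1 - S * S div max S (zeta_fixed S N k - zeta_fixed_err S N k - 1)"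

text \<open>Write \<open>S / zeta (real k)\<close> as \<open>S * S\<close> divided by
  \<open>S * zeta (real k)\<close>. An upper bound of the divisor gives the upper bound here, with
  the rounding already on the safe side.\<close>

lemma coeff_bounds:
  assumes "2 \<le> k" "1 \<le> N" "0 < S"
  shows "real_of_int S * (1 - 1 / zeta (real k)) \<le> real_of_int (coeff_upper S N k)"
    and "real_of_int (coeff_lower S N k) \<le> real_of_int S * (1 - 1 / zeta (real k))"
proof -
  have z: "1 \<le> zeta (real k)" using zeta_ge_1 assms(1) by simp
  have S: "0 < real_of_int S" using assms(3) by simp
  define U where "U = zeta_fixed S N k + int N + 3"
  define L where "L = max S (zeta_fixed S N k - zeta_fixed_err S N k - 1)"
  have U: "real_of_int S * zeta (real k) \<le> real_of_int U"
    using zeta_fixed_bounds(1)[OF assms(1,2), of S] assms(3) by (simp add: U_def)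
  have "0 < real_of_int S * zeta (real k)" using z S by simp
  then have U0: "0 < U" using U by linarith
  have L: "real_of_int L \<le> real_of_int S * zeta (real k)"
    using zeta_fixed_bounds(2)[OF assms(1,2), of S] assms(3) z by (simp add: L_def max_def)
  have L0: "0 < L" using assms(3) by (simp add: L_def)
  have "real_of_int (S * S div U) \<le> real_of_int S * real_of_int S / real_of_int U"
    using real_of_int_div_bounds(1)[OF U0, of "S * S"] by simp
  also have "\<dots> \<le> real_of_int S / zeta (real k)"
    using mult_left_mono[OF U, of "real_of_int S"] S U0 z by (simp add: field_simps)
  finally show "real_of_int S * (1 - 1 / zeta (real k)) \<le> real_of_int (coeff_upper S N k)"
    by (simp add: coeff_upper_def U_def right_diff_distrib)
  have "real_of_int S / zeta (real k) \<le> real_of_int S * real_of_int S / real_of_int L"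
    using mult_left_mono[OF L, of "real_of_int S"] S L0 z by (simp add: field_simps)
  also have "\<dots> \<le> real_of_int (S * S div L) + 1"
    using real_of_int_div_bounds(2)[OF L0, of "S * S"] by simp
  finally show "real_of_int (coeff_lower S N k) \<le> real_of_int S * (1 - 1 / zeta (real k))"
    by (simp add: coeff_lower_def L_def right_diff_distrib)
qed

section \<open>Counting integers with a high exponent\<close>

definition mu :: "nat \<Rightarrow> real" where
  "mu d = (if squarefree d then (-1) ^ card (prime_factors d) else 0)"

lemma mu_1 [simp]: "mu 1 = 1" "mu (Suc 0) = 1"
  by (simp_all add: mu_def)

lemma abs_mu_le_1: "\<bar>mu d\<bar> \<le> 1"
  by (simp add: mu_def)

lemma mu_prime_mult:
  assumes "prime p" "\<not> p dvd d"
  shows "mu (p * d) = - mu d"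
proof -
  have "d \<noteq> 0" using assms(2) by (metis dvd_0_right)
  then have "prime_factors (p * d) = insert p (prime_factors d)"
    using assms(1) prime_gt_0_nat[OF assms(1)] by (simp add: prime_factors_product prime_prime_factors)
  moreover have "p \<notin> prime_factors d"
    using assms(2) by (auto dest: in_prime_factors_imp_dvd)
  moreover have "squarefree (p * d) \<longleftrightarrow> squarefree d"
    using assms squarefree_mult_coprime[of p d] squarefree_multD[of p d]
    by (auto simp: squarefree_prime prime_imp_coprime)
  ultimately show ?thesis by (simp add: mu_def)
qed

lemma mu_prime_mult_eq_0:
  assumes "prime p" "p dvd d"
  shows "mu (p * d) = 0"
proof -
  have "\<not> squarefree (p * d)"
    by (rule not_squarefreeI[of p]) (use assms in \<open>auto simp: power2_eq_square mult_dvd_mono\<close>)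
  then show ?thesis by (simp add: mu_def)
qed

text \<open>The involution \<open>d \<leftrightarrow> p d\<close> on the elements with \<open>mu d \<noteq> 0\<close> flips the sign.\<close>

lemma sum_mu_eq_0:
  assumes "finite S" "prime p" and S: "\<And>d. \<not> p dvd d \<Longrightarrow> d \<in> S \<longleftrightarrow> p * d \<in> S"
  shows "sum mu S = 0"
proof -
  let ?A = "{d \<in> S. \<not> p dvd d}" and ?B = "{d \<in> S. p dvd d}"
  have "sum mu ?B = sum mu ((*) p ` ?A)"
  proof (rule sum.mono_neutral_right)
    show "\<forall>d\<in>?B - (*) p ` ?A. mu d = 0"
    proof
      fix d assume d: "d \<in> ?B - (*) p ` ?A"
      then obtain e where e: "d = p * e" by auto
      \<comment> \<open>Otherwise \<open>e\<close> would lie in \<open>?A\<close> by the closure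
        property, and \<open>d\<close> in its image.\<close>
      then have "p dvd e" using d S[of e] by auto
      then show "mu d = 0" unfolding e by (rule mu_prime_mult_eq_0[OF assms(2)])
    qed
  qed (use assms in auto)
  also have "\<dots> = (\<Sum>d\<in>?A. mu (p * d))"
    using prime_gt_0_nat[OF assms(2)] by (subst sum.reindex) (auto simp: inj_on_def)
  also have "\<dots> = - sum mu ?A"
    unfolding sum_negf[symmetric] by (intro sum.cong) (auto simp: mu_prime_mult[OF assms(2)])
  finally have "sum mu ?A + sum mu ?B = 0" by simp
  moreover have "sum mu S = sum mu (?A \<union> ?B)"
    by (rule arg_cong[of _ _ "sum mu"]) auto
  ultimately show ?thesis
    using assms(1) by (subst (asm) sum.union_disjoint[symmetric]) auto
qed

lemma power_dvd_le:
  assumes "1 \<le> k" "0 < n" "d ^ k dvd (n::nat)"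
  shows "1 \<le> d" "d \<le> n"
proof -
  show "1 \<le> d"
    using assms by (cases "d = 0") (auto simp: power_0_left)
  have "d \<le> d ^ k" using assms(1) \<open>1 \<le> d\<close> by (simp add: self_le_power)
  also have "\<dots> \<le> n" using assms by (simp add: dvd_imp_le)
  finally show "d \<le> n" .
qed

text \<open>If \<open>p ^ k\<close> divides \<open>n\<close>, then for \<open>d\<close> prime to
  \<open>p\<close> the conditions on \<open>d\<close> and \<open>p * d\<close> agree, and the sum
  cancels in pairs. Otherwise only \<open>d = 1\<close> contributes. The case \<open>k = 1\<close>
  is the classical divisor sum.\<close>

lemma sum_mu_power_dvd:
  assumes "1 \<le> k" "0 < n"
  shows "(\<Sum>d | d ^ k dvd n. mu d) = (if \<exists>p. prime p \<and> p ^ k dvd n then 0 else 1)"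
proof -
  have fin: "finite {d. d ^ k dvd n}"
    by (rule finite_subset[of _ "{..n}"]) (use power_dvd_le[OF assms] in auto)
  show ?thesis
  proof (cases "\<exists>p. prime p \<and> p ^ k dvd n")
    case True
    then obtain p where p: "prime p" "p ^ k dvd n" by auto
    have "(\<Sum>d | d ^ k dvd n. mu d) = 0"
    proof (rule sum_mu_eq_0[OF fin p(1)])
      fix d assume "\<not> p dvd d"
      then have "coprime (p ^ k) (d ^ k)"
        using p(1) by (simp add: prime_imp_coprime)
      then show "d \<in> {d. d ^ k dvd n} \<longleftrightarrow> p * d \<in> {d. d ^ k dvd n}"
        using p(2) by (auto simp: power_mult_distrib intro: divides_mult dest: dvd_mult_right)
    qed
    then show ?thesis using True by simp
  next
    case False
    have "d = 1" if "d ^ k dvd n" for d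
    proof (rule ccontr)
      assume "d \<noteq> 1"
      then obtain p where p: "prime p" "p dvd d" using prime_factor_nat by blast
      then have "p ^ k dvd n" using that dvd_power_same[of p d k] dvd_trans by blast
      then show False using False p(1) by blast
    qed
    then have "{d. d ^ k dvd n} = {1}" by auto
    then show ?thesis using False by simp
  qed
qed

text \<open>Turns the maximum into a divisibility condition that Moebius inversion can detect. With
  \<open>2 \<le> k\<close> the conventional value at 1, which comes from no prime, does no
  harm.\<close>

lemma le_max_exponent_iff:
  assumes "2 \<le> k" "0 < n"
  shows "k \<le> max_exponent n \<longleftrightarrow> (\<exists>p. prime p \<and> p ^ k dvd n)"
proof (cases "n = 1")
  case True
  then show ?thesis
    using assms(1) by (auto simp: max_exponent_def)
next
  case False
  then have ne: "prime_factors n \<noteq> {}"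
    using assms(2) prime_factor_nat[OF False] by (auto simp: prime_factors_dvd)
  then have "k \<le> max_exponent n \<longleftrightarrow> (\<exists>p\<in>prime_factors n. k \<le> multiplicity p n)"
    using False by (simp add: max_exponent_def Max_ge_iff)
  also have "\<dots> \<longleftrightarrow> (\<exists>p. prime p \<and> p ^ k dvd n)"
  proof safe
    fix p assume p: "p \<in> prime_factors n" "k \<le> multiplicity p n"
    then show "\<exists>p. prime p \<and> p ^ k dvd n"
      using assms(2) by (auto simp: multiplicity_dvd' in_prime_factors_iff)
  next
    fix p :: nat assume p: "prime p" "p ^ k dvd n"
    then have "p dvd n" using assms(1) dvd_trans[OF dvd_power[of k p]] by auto
    then have "p \<in> prime_factors n" using p assms(2) by (simp add: prime_factors_dvd)
    moreover have "k \<le> multiplicity p n"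
      by (rule multiplicity_geI) (use p assms(2) in \<open>auto dest: prime_gt_1_nat\<close>)
    ultimately show "\<exists>p\<in>prime_factors n. k \<le> multiplicity p n" by blast
  qed
  finally show ?thesis .
qed

section \<open>Squares of maximal exponents as weighted layer sums\<close>

lemma max_exponent_ge_1:
  assumes "0 < n"
  shows "1 \<le> max_exponent n"
proof (cases "n = 1")
  case False
  then obtain p where p: "prime p" "p dvd n" using prime_factor_nat by blast
  then have p': "p \<in> prime_factors n" using assms by (simp add: prime_factors_dvd)
  then have "1 \<le> multiplicity p n"
    using assms p by (intro multiplicity_geI) (auto dest: prime_gt_1_nat)
  also have "\<dots> \<le> Max ((\<lambda>p. multiplicity p n) ` prime_factors n)"
    using p' by (intro Max_ge) auto
  finally show ?thesis using False by (simp add: max_exponent_def)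
qed (simp add: max_exponent_def)

lemma prime_power_dvd_imp_le:
  assumes "prime p" "p ^ k dvd n" "0 < (n::nat)"
  shows "2 ^ k \<le> n"
proof -
  have "2 ^ k \<le> p ^ k" using prime_ge_2_nat[OF assms(1)] by (simp add: power_mono)
  also have "\<dots> \<le> n" using assms by (simp add: dvd_imp_le)
  finally show ?thesis .
qed

text \<open>A crude bound from \<open>2 ^ M \<le> n\<close> for \<open>M = max_exponent n\<close>;
  it serves to make the layer sums finite.\<close>

lemma max_exponent_le:
  assumes "0 < n"
  shows "max_exponent n \<le> n"
proof (cases "2 \<le> max_exponent n")
  case True
  then obtain p where "prime p" "p ^ max_exponent n dvd n"
    using le_max_exponent_iff[OF True assms] by auto
  then have "2 ^ max_exponent n \<le> n" using assms by (rule prime_power_dvd_imp_le)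
  then show ?thesis using less_exp[of "max_exponent n"] by linarith
qed (use assms in simp)

text \<open>Sum of the odd numbers from 3 to \<open>2 * M - 1\<close>. The index \<open>j\<close>
  stands for the exponent \<open>k = j + 2\<close>, with weight
  \<open>2 * k - 1 = 2 * j + 3\<close>, and \<open>J\<close> is a cutoff common to all
  \<open>M\<close>.\<close>

lemma sum_odd_upto:
  fixes M :: nat
  assumes "1 \<le> M" "M \<le> Suc J"
  shows "(\<Sum>j<J. (2 * real j + 3) * of_bool (j + 2 \<le> M)) = real M ^ 2 - 1"
proof -
  have "(\<Sum>j<J. (2 * real j + 3) * of_bool (j + 2 \<le> M)) = (\<Sum>j<M - 1. (2 * real j + 3) * of_bool (j + 2 \<le> M))"
    by (rule sum.mono_neutral_right) (use assms in auto)
  also have "\<dots> = (\<Sum>j<M - 1. 2 * real j + 3)"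
    by (intro sum.cong) auto
  also have "\<dots> = (real (M - 1) + 1) ^ 2 - 1"
  proof -
    have "(\<Sum>j<i. 2 * real j + 3) = (real i + 1) ^ 2 - 1" for i
      by (induction i) (simp_all add: power2_eq_square algebra_simps)
    then show ?thesis .
  qed
  finally show ?thesis using assms by simp
qed

definition high_exponents :: "nat \<Rightarrow> nat \<Rightarrow> nat set" where
  "high_exponents k N = {n \<in> {1..N}. k \<le> max_exponent n}"

lemma sum_max_exponent_square:
  assumes "N \<le> J"
  shows "(\<Sum>n = 1..N. real (max_exponent n) ^ 2)
    = real N + (\<Sum>j<J. (2 * real j + 3) * real (card (high_exponents (j + 2) N)))"
proof -
  have "(\<Sum>n = 1..N. real (max_exponent n) ^ 2) =
      (\<Sum>n = 1..N. 1 + (\<Sum>j<J. (2 * real j + 3) * of_bool (j + 2 \<le> max_exponent n)))"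
  proof (rule sum.cong)
    fix n assume "n \<in> {1..N}"
    then show "real (max_exponent n) ^ 2 = 1 + (\<Sum>j<J. (2 * real j + 3) * of_bool (j + 2 \<le> max_exponent n))"
      using max_exponent_ge_1[of n] max_exponent_le[of n] assms
      by (subst sum_odd_upto) auto
  qed simp
  also have "\<dots> = real N + (\<Sum>j<J. \<Sum>n = 1..N. (2 * real j + 3) * of_bool (j + 2 \<le> max_exponent n))"
    by (subst sum.swap) (simp add: sum.distrib)
  also have "\<dots> = real N + (\<Sum>j<J. (2 * real j + 3) * real (card (high_exponents (j + 2) N)))"
    unfolding high_exponents_def sum_distrib_left[symmetric] by (simp add: of_bool_def sum.If_cases Int_def)
  finally show ?thesis .
qed

section \<open>Counting by Moebius inversion\<close>

lemma card_multiples: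
  assumes "0 < q"
  shows "card {n \<in> {1..N}. q dvd n} = N div (q::nat)"
proof -
  have "{n \<in> {1..N}. q dvd n} = (*) q ` {1..N div q}"
    using assms by (auto simp: less_eq_div_iff_mult_less_eq ac_simps elim!: dvdE intro!: imageI)
  then show ?thesis
    using assms by (simp add: card_image inj_on_def)
qed

text \<open>Sum the \<open>k\<close>-free indicator over \<open>n\<close> and exchange the
  summations. A \<open>d\<close> with \<open>d ^ k dvd n\<close> and \<open>n \<le> N\<close> is at
  most \<open>m\<close>, so stopping at \<open>m\<close> is exact.\<close>

lemma card_high_exponents:
  assumes "2 \<le> k" "N < (m + 1) ^ k"
  shows "real (card (high_exponents k N)) = real N - (\<Sum>d = 1..m. mu d * real (N div d ^ k))"
proof -
  have *: "of_bool (k \<le> max_exponent n) = 1 - (\<Sum>d = 1..m. mu d * of_bool (d ^ k dvd n))"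
    if n: "n \<in> {1..N}" for n
  proof -
    have "d \<le> m" if "d ^ k dvd n" for d
    proof (rule ccontr)
      assume "\<not> d \<le> m"
      then have "(m + 1) ^ k \<le> d ^ k" by (intro power_mono) auto
      also have "\<dots> \<le> n" using that n by (simp add: dvd_imp_le)
      finally show False using n assms(2) by simp
    qed
    then have "{d. d ^ k dvd n} = {d \<in> {1..m}. d ^ k dvd n}"
      using power_dvd_le(1)[of k n] n assms(1) by force
    then have "(\<Sum>d | d ^ k dvd n. mu d) = (\<Sum>d = 1..m. mu d * of_bool (d ^ k dvd n))"
      by (simp only: sum.inter_filter[OF finite_atLeastAtMost]) (intro sum.cong, auto)
    then show ?thesis
      using sum_mu_power_dvd[of k n] n assms(1) le_max_exponent_iff[of k n] by auto
  qed
  have "real (card (high_exponents k N)) = (\<Sum>n = 1..N. of_bool (k \<le> max_exponent n))"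
    by (simp add: high_exponents_def of_bool_def sum.If_cases Int_def)
  also have "\<dots> = (\<Sum>n = 1..N. 1 - (\<Sum>d = 1..m. mu d * of_bool (d ^ k dvd n)))"
    by (intro sum.cong *) auto
  also have "\<dots> = real N - (\<Sum>d = 1..m. mu d * (\<Sum>n = 1..N. of_bool (d ^ k dvd n)))"
    unfolding sum_distrib_left by (subst sum.swap) (simp add: sum_subtractf)
  also have "\<dots> = real N - (\<Sum>d = 1..m. mu d * real (N div d ^ k))"
  proof -
    have "(\<Sum>n = 1..N. of_bool (d ^ k dvd n)) = real (N div d ^ k)" if "d \<in> {1..m}" for d
      using card_multiples[of "d ^ k" N] that by (simp add: of_bool_def sum.If_cases Int_def)
    then show ?thesis by simp
  qed
  finally show ?thesis .
qed

section \<open>The Dirichlet series of \<open>mu\<close> and estimates uniform in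
  \<open>k\<close>\<close>

lemma zeta_nat_sums:
  assumes "2 \<le> k"
  shows "(\<lambda>n. 1 / real (Suc n) ^ k) sums zeta (real k)"
proof -
  have "(\<lambda>n. 1 / real (Suc n) powr real k) sums zeta (real k)"
    unfolding zeta_def by (intro summable_sums zeta_summable) (use assms in simp)
  then show ?thesis by (simp only: powr_realpow of_nat_0_less_iff zero_less_Suc)
qed

lemma bij_betw_Suc_pos: "bij_betw Suc UNIV {0<..}"
  by (rule bij_betwI[of _ _ _ "\<lambda>n. n - 1"]) auto

lemma mu_summable:
  assumes "2 \<le> k"
  shows "summable (\<lambda>n. norm (mu (Suc n) / real (Suc n) ^ k))"
  by (rule summable_comparison_test'[OF sums_summable[OF zeta_nat_sums[OF assms]], of 0])
    (auto simp: abs_mu_le_1 divide_right_mono)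

text \<open>Dirichlet product of two absolutely convergent series. Grouping the pairs by their
  product leaves the divisor sums of \<open>mu\<close>, which vanish except at 1.\<close>

lemma mu_sums:
  assumes k: "2 \<le> k"
  shows "(\<lambda>n. mu (Suc n) / real (Suc n) ^ k) sums (1 / zeta (real k))"
proof -
  define f where "f n = mu n / real n ^ k" for n
  define g where "g n = 1 / real n ^ k" for n
  define P where "P = {0::nat<..}"
  note bij = bij_betw_Suc_pos[folded P_def]
  define C where "C = (\<Sum>n. f (Suc n))"
  let ?z = "zeta (real k)"
  have f_sums: "(\<lambda>n. f (Suc n)) sums C"
    unfolding C_def f_def by (rule summable_sums[OF summable_norm_cancel[OF mu_summable[OF k]]])
  have sf: "summable (\<lambda>n. norm (f (Suc n)))"
    using mu_summable[OF k] by (simp only: f_def)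
  have "((\<lambda>n. f (Suc n)) has_sum C) UNIV"
    by (rule norm_summable_imp_has_sum[OF sf f_sums])
  then have f_sum: "(f has_sum C) P"
    using has_sum_reindex_bij_betw[OF bij, of f] by simp
  have "((\<lambda>n. norm (f (Suc n))) has_sum (\<Sum>n. norm (f (Suc n)))) UNIV"
    by (rule norm_summable_imp_has_sum) (use sf in \<open>auto intro: summable_sums\<close>)
  then have nf_sum: "((\<lambda>n. norm (f n)) has_sum (\<Sum>n. norm (f (Suc n)))) P"
    using has_sum_reindex_bij_betw[OF bij, of "\<lambda>n. norm (f n)"] by simp
  have g_sums: "(\<lambda>n. g (Suc n)) sums ?z"
    using zeta_nat_sums[OF k] by (simp only: g_def)
  have "((\<lambda>n. g (Suc n)) has_sum ?z) UNIV"
    by (rule norm_summable_imp_has_sum[OF _ g_sums]) (use g_sums in \<open>simp add: g_def sums_iff\<close>)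
  then have g_sum: "(g has_sum ?z) P"
    using has_sum_reindex_bij_betw[OF bij, of g] by simp
  have "(\<lambda>x. norm (f (fst x) * g (snd x))) summable_on P \<times> P"
  proof (rule summable_on_SigmaI)
    show "((\<lambda>y. norm (f (fst (x, y)) * g (snd (x, y)))) has_sum norm (f x) * ?z) P" for x
      using has_sum_cmult_right[OF g_sum, of "norm (f x)"] by (simp add: abs_mult g_def)
    show "(\<lambda>x. norm (f x) * ?z) summable_on P"
      using has_sum_cmult_left[OF nf_sum] by (rule has_sum_imp_summable)
  qed auto
  then have "(\<lambda>x. f (fst x) * g (snd x)) summable_on P \<times> P"
    by (rule abs_summable_summable)
  then obtain h where h: "((\<lambda>x. f (fst x) * g (snd x)) has_sum h) (P \<times> P)"
    by (auto simp: summable_on_def)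
  \<comment> \<open>Summing the double series by rows gives the product of the two sums.\<close>
  have "((\<lambda>x. f x * ?z) has_sum h) P"
    by (rule has_sum_SigmaD[OF h]) (use has_sum_cmult_right[OF g_sum] in simp)
  then have h_eq: "h = C * ?z"
    using has_sum_cmult_left[OF f_sum] has_sum_unique by blast
  \<comment> \<open>The pair \<open>(d, m)\<close> becomes \<open>(d * m, d)\<close>, so the outer
    index is now the product.\<close>
  have "((\<lambda>x. f (snd x) * g (fst x div snd x)) has_sum h) (Sigma P (\<lambda>n. {d. d dvd n}))"
    by (rule iffD1[OF has_sum_reindex_bij_witness[of _ "\<lambda>(n, d). (d, n div d)" "\<lambda>(d, m). (d * m, d)"] h])
      (auto simp: P_def elim!: dvdE)
  then have "((\<lambda>n. of_bool (n = 1)) has_sum h) P"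
  proof (rule has_sum_SigmaD)
    fix n assume n: "n \<in> P"
    have "(\<Sum>d | d dvd n. f d * g (n div d)) = (\<Sum>d | d dvd n. mu d) / real n ^ k"
      unfolding sum_divide_distrib
    proof (rule sum.cong)
      fix d assume "d \<in> {d. d dvd n}"
      then obtain e where "n = d * e" by auto
      with n show "f d * g (n div d) = mu d / real n ^ k"
        by (auto simp: f_def g_def P_def power_mult_distrib)
    qed simp
    also have "\<dots> = of_bool (n = 1)"
      using sum_mu_power_dvd[of 1 n] n prime_factor_nat[of n] by (auto simp: P_def)
    finally show "((\<lambda>d. f (snd (n, d)) * g (fst (n, d) div snd (n, d))) has_sum of_bool (n = 1)) {d. d dvd n}"
      using n by (auto intro!: has_sum_finiteI simp: P_def)
  qed
  moreover have "((\<lambda>n. of_bool (n = 1)) has_sum (1::real)) P"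
    by (rule has_sum_finite_neutralI[of "{1}"]) (auto simp: P_def)
  ultimately have "h = 1" using has_sum_unique by blast
  with h_eq zeta_ge_1[of "real k"] k have "C = 1 / ?z" by (simp add: field_simps)
  with f_sums show ?thesis by (simp only: f_def)
qed

text \<open>From \<open>x ^ k \<ge> M ^ (k - 2) * x^2\<close> and
  \<open>2 * x^2 \<ge> x * (x + 1)\<close> for \<open>x = M + i\<close>, the terms are dominated by
  a telescoping series. The constant 2 is independent of \<open>k\<close> and
  \<open>M\<close>.\<close>

lemma inverse_power_tail:
  assumes k: "2 \<le> k" and M: "1 \<le> M"
  shows "summable (\<lambda>i. 1 / real (M + i) ^ k)" "(\<Sum>i. 1 / real (M + i) ^ k) \<le> 2 / real M ^ (k - 1)"
proof -
  have "summable (\<lambda>i. 1 / real (Suc (i + (M - 1))) ^ k)"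
    by (rule summable_ignore_initial_segment[OF sums_summable[OF zeta_nat_sums[OF k]]])
  moreover have "Suc (i + (M - 1)) = M + i" for i using M by simp
  ultimately show S: "summable (\<lambda>i. 1 / real (M + i) ^ k)" by (simp only:)
  define g where "g i = 2 / (real M ^ (k - 2) * (real M + real i))" for i
  have "(\<Sum>i. 1 / real (M + i) ^ k) \<le> g 0"
  proof (rule suminf_le_telescope[OF S])
    fix i
    let ?x = "real M + real i"
    have x: "1 \<le> ?x" using M by linarith
    have M0: "0 < real M ^ (k - 2)" using M by simp
    have "?x * (?x + 1) \<le> ?x * (2 * ?x)"
      using x by (intro mult_left_mono) auto
    then have "real M ^ (k - 2) * (?x * (?x + 1)) \<le> real M ^ (k - 2) * (2 * ?x ^ 2)"
      using M0 by (intro mult_left_mono) (auto simp: power2_eq_square algebra_simps)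
    also have "\<dots> \<le> ?x ^ (k - 2) * (2 * ?x ^ 2)"
      by (intro mult_right_mono power_mono) auto
    also have "\<dots> = 2 * ?x ^ k"
      by (subst le_add_diff_inverse2[OF k, symmetric], subst power_add) (simp add: mult.left_commute)
    finally have "2 / (2 * ?x ^ k) \<le> 2 / (real M ^ (k - 2) * (?x * (?x + 1)))"
      using x M0 by (intro divide_left_mono mult_pos_pos zero_less_power) (use M in auto)
    then have "1 / ?x ^ k \<le> 2 / (real M ^ (k - 2) * (?x * (?x + 1)))" by simp
    also have "\<dots> = g i - g (Suc i)"
    proof -
      have "2 / (c * (y * (y + 1))) = 2 / (c * y) - 2 / (c * (y + 1))" if "c \<noteq> 0" "y \<noteq> 0" "y + 1 \<noteq> 0" for c y :: real
        using that by (simp add: divide_simps)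
      from this[of "real M ^ (k - 2)" ?x] show ?thesis
        using x M0 M by (simp add: g_def ac_simps)
    qed
    finally show "1 / real (M + i) ^ k \<le> g i - g (Suc i)" by simp
  next
    have "(\<lambda>i. 2 / real M ^ (k - 2) * inverse (real M + real i)) \<longlonglongrightarrow> 2 / real M ^ (k - 2) * 0"
      by (intro tendsto_mult tendsto_const tendsto_inverse_0_at_top filterlim_add_real_at_top)
    moreover have "g = (\<lambda>i. 2 / real M ^ (k - 2) * inverse (real M + real i))"
      by (rule ext) (simp add: g_def divide_inverse)
    ultimately show "g \<longlonglongrightarrow> 0" by (simp only: mult_zero_right)
  qed
  also have "g 0 = 2 / real M ^ (k - 1)"
  proof -
    have "k - 1 = Suc (k - 2)" using k by simp
    then show ?thesis by (simp add: g_def mult.commute)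
  qed
  finally show "(\<Sum>i. 1 / real (M + i) ^ k) \<le> 2 / real M ^ (k - 1)" .
qed

text \<open>For \<open>z \<ge> 1\<close> one has \<open>1 - 1 / z \<le> z - 1\<close>, and
  \<open>zeta (real k) - 1\<close> is the tail starting at 2.\<close>

lemma one_minus_inverse_zeta:
  assumes "2 \<le> k"
  shows "0 \<le> 1 - 1 / zeta (real k)" "1 - 1 / zeta (real k) \<le> 4 / 2 ^ k"
proof -
  have z: "1 \<le> zeta (real k)" using zeta_ge_1 assms by simp
  then show "0 \<le> 1 - 1 / zeta (real k)" by simp
  have "zeta (real k) = (\<Sum>n. 1 / real (Suc (Suc n)) ^ k) + 1"
    using sums_unique[OF zeta_nat_sums[OF assms]] suminf_split_head[OF sums_summable[OF zeta_nat_sums[OF assms]]]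
    by simp
  also have "\<dots> \<le> 2 / 2 ^ (k - 1) + 1"
    using inverse_power_tail(2)[OF assms, of 2] by simp
  also have "2 / 2 ^ (k - 1) = 4 / (2::real) ^ k"
    using assms by (cases k) simp_all
  finally have "zeta (real k) - 1 \<le> 4 / 2 ^ k" by simp
  moreover have "1 - 1 / zeta (real k) \<le> zeta (real k) - 1"
  proof -
    have "1 - 1 / zeta (real k) = (zeta (real k) - 1) / zeta (real k)" using z by (simp add: field_simps)
    also have "\<dots> \<le> zeta (real k) - 1" 
      using z mult_left_mono[of 1 "zeta (real k)" "zeta (real k) - 1"] by (simp add: divide_le_eq)
    finally show ?thesis .
  qed
  ultimately show "1 - 1 / zeta (real k) \<le> 4 / 2 ^ k" by linarith
qed

section \<open>The density of integers with a high exponent\<close>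

lemma div_approx:
  assumes "real N \<le> x" "x < real N + 1" "0 < q"
  shows "\<bar>real (N div q) - x / real q\<bar> \<le> 1"
proof -
  have "real (N div q) \<le> real N / real q" by (rule of_nat_div_le_of_nat) 
  also have "\<dots> \<le> x / real q" using assms by (simp add: divide_right_mono)
  finally have 1: "real (N div q) \<le> x / real q" .
  have "N < q * (N div q + 1)"
    using assms(3) by (simp add: dividend_less_times_div)
  then have "N + 1 \<le> q * (N div q + 1)" by simp
  then have "real N + 1 \<le> real q * (real (N div q) + 1)"
    by (metis of_nat_1 of_nat_add of_nat_le_iff of_nat_mult)
  then have "x / real q \<le> real (N div q) + 1"
    using assms by (simp add: field_simps)
  with 1 show ?thesis by simp
qed

text \<open>Three errors add up: at most 1 from \<open>N\<close> against \<open>x\<close>, at most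
  \<open>m\<close> from the rounded quotients, and at most \<open>2 * m + 2\<close> from the tail of
  the \<open>mu\<close> series beyond \<open>m\<close>.\<close>

lemma high_exponents_density_root:
  assumes k: "2 \<le> k" and x: "real N \<le> x" "x < real N + 1" and m: "N < (m + 1) ^ k"
  shows "\<bar>real (card (high_exponents k N)) - x * (1 - 1 / zeta (real k))\<bar> \<le> 3 * real m + 3"
proof -
  define f where "f d = mu d / real d ^ k" for d
  have f_sums: "(\<lambda>n. f (Suc n)) sums (1 / zeta (real k))"
    using mu_sums[OF k] by (simp only: f_def)
  define T where "T = (\<Sum>n. f (Suc (n + m)))"
  have split: "1 / zeta (real k) = T + (\<Sum>d = 1..m. f d)"
  proof -
    have "(\<Sum>d = 1..m. f d) = (\<Sum>n<m. f (Suc n))"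
      using sum.atLeast1_atMost_eq[of f m] by simp
    then show ?thesis
      using suminf_split_initial_segment[OF sums_summable[OF f_sums], of m] sums_unique[OF f_sums]
      by (simp add: T_def)
  qed
  note tail = inverse_power_tail[OF k, of "m + 1"]
  have bound: "norm (f (Suc (n + m))) \<le> 1 / real (m + 1 + n) ^ k" for n
    using abs_mu_le_1[of "Suc (n + m)"] by (simp add: f_def ac_simps divide_right_mono)
  have "summable (\<lambda>n. norm (f (Suc (n + m))))"
    by (rule summable_comparison_test'[OF tail(1), of 0]) (use bound in auto)
  then have "\<bar>T\<bar> \<le> (\<Sum>n. norm (f (Suc (n + m))))"
    unfolding T_def using summable_norm[of "\<lambda>n. f (Suc (n + m))"] by simp
  also have "\<dots> \<le> (\<Sum>n. 1 / real (m + 1 + n) ^ k)"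
    by (intro suminf_le bound tail(1)) (use \<open>summable (\<lambda>n. norm (f (Suc (n + m))))\<close> in auto)
  also have "\<dots> \<le> 2 / real (m + 1) ^ (k - 1)"
    by (rule tail(2)) simp
  finally have T: "\<bar>T\<bar> \<le> 2 / real (m + 1) ^ (k - 1)" .
  have "N + 1 \<le> (m + 1) ^ k" using m by simp
  then have "real N + 1 \<le> real (m + 1) ^ k"
    by (metis of_nat_1 of_nat_add of_nat_le_iff of_nat_power)
  then have "x \<le> real (m + 1) * real (m + 1) ^ (k - 1)"
    using x k by (simp flip: power_Suc)
  then have "x * (2 / real (m + 1) ^ (k - 1)) \<le> 2 * real (m + 1)"
    by (simp add: field_simps)
  moreover have "x * \<bar>T\<bar> \<le> x * (2 / real (m + 1) ^ (k - 1))"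
    using T x by (intro mult_left_mono) auto
  ultimately have xT: "\<bar>x * T\<bar> \<le> 2 * real m + 2"
    using x by (simp add: abs_mult)
  define D where "D = (\<Sum>d = 1..m. mu d * (real (N div d ^ k) - x / real (d ^ k)))"
  have "\<bar>D\<bar> \<le> (\<Sum>d = 1..m. 1)"
    unfolding D_def
  proof (rule order_trans[OF sum_abs sum_mono])
    fix d assume "d \<in> {1..m}"
    then show "\<bar>mu d * (real (N div d ^ k) - x / real (d ^ k))\<bar> \<le> 1"
      unfolding abs_mult by (intro mult_le_one abs_mu_le_1 div_approx[OF x]) auto
  qed
  then have D: "\<bar>D\<bar> \<le> real m" by simp
  have "D = (\<Sum>d = 1..m. mu d * real (N div d ^ k)) - x * (\<Sum>d = 1..m. f d)"
    by (simp add: D_def f_def right_diff_distrib sum_subtractf sum_distrib_left mult.commute)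
  then have "real (card (high_exponents k N)) - x * (1 - 1 / zeta (real k)) = (real N - x) - D + x * T"
    using card_high_exponents[OF k m] unfolding split by (simp add: algebra_simps)
  then show ?thesis using x D xT by linarith
qed

text \<open>The geometric factor makes the bound summable over \<open>k\<close>. The base
  \<open>q\<close> comes from \<open>x powr (1/3) = sqrt x * x powr (-1/6)\<close>, the root bound
  for \<open>k \<ge> 3\<close>, combined with \<open>2 ^ k \<le> x\<close>.\<close>

lemma high_exponents_density:
  defines "q \<equiv> 2 powr (- 1 / 6)"
  assumes k: "2 \<le> k" and x: "1 \<le> x" "real N \<le> x" "x < real N + 1"
  shows "\<bar>real (card (high_exponents k N)) - x * (1 - 1 / zeta (real k))\<bar> \<le> 12 * sqrt x * q ^ k"
proof -
  have qk: "q ^ k = 2 powr (- real k / 6)"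
    by (simp add: q_def powr_power mult.commute)
  have N: "1 \<le> N" using x by linarith
  have sx: "0 < sqrt x" "sqrt x * sqrt x = x" using x by auto
  show ?thesis
  proof (cases "N < 2 ^ k")
    case True
    have "\<not> k \<le> max_exponent n" if n: "n \<in> {1..N}" for n
    proof
      assume "k \<le> max_exponent n"
      then obtain p where "prime p" "p ^ k dvd n"
        using le_max_exponent_iff[OF k, of n] n by auto
      then have "2 ^ k \<le> n" using n by (intro prime_power_dvd_imp_le) auto
      then show False using n True by simp
    qed
    then have "high_exponents k N = {}" by (auto simp: high_exponents_def)
    then have "\<bar>real (card (high_exponents k N)) - x * (1 - 1 / zeta (real k))\<bar> = x * (1 - 1 / zeta (real k))"
      using one_minus_inverse_zeta(1)[OF k] x by simp
    also have "\<dots> \<le> x * (4 / 2 ^ k)"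
      using one_minus_inverse_zeta(2)[OF k] x by (intro mult_left_mono) auto
    also have "\<dots> = 4 * sqrt x * (sqrt x / 2 ^ k)"
      by (subst sx(2)[symmetric]) (simp only: times_divide_eq_right mult_ac)
    \<comment> \<open>Here \<open>x \<le> 2 ^ k\<close>, so the quotient is at most
      \<open>2 powr (- k / 2)\<close>, which is even smaller than needed.\<close>
    also have "sqrt x / 2 ^ k \<le> q ^ k"
    proof -
      have "real (N + 1) \<le> real (2 ^ k)" using True by (intro of_nat_mono) simp
      then have "sqrt x \<le> sqrt (2 powr real k)"
        using x by (simp add: powr_realpow)
      also have "\<dots> = 2 powr (real k / 2)"
        by (subst powr_half_sqrt[symmetric]) (simp_all add: powr_powr)
      finally have "sqrt x / 2 ^ k \<le> 2 powr (real k / 2) / 2 powr real k"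
        by (simp add: powr_realpow divide_right_mono)
      also have "\<dots> = 2 powr (- real k / 2)"
        by (simp add: powr_diff[symmetric])
      also have "\<dots> \<le> q ^ k"
        unfolding qk by (intro powr_mono) auto
      finally show ?thesis .
    qed
    finally show ?thesis using sx by (simp add: mult_left_mono)
  next
    case False
    define m where "m = nth_root_nat k N"
    have mk: "m ^ k \<le> N"
      using k by (simp add: m_def nth_root_nat_power_le)
    have m: "N < (m + 1) ^ k"
      using nth_root_nat_ge[of k "m + 1" N] k by (force simp: m_def)
    have m1: "1 \<le> m"
      unfolding m_def using N k by (intro nth_root_nat_ge) auto
    have mx: "real m ^ k \<le> x"
      using mk x by (metis of_nat_le_iff of_nat_power order_trans)
    \<comment> \<open>For \<open>k = 2\<close> the root is only bounded by \<open>sqrt x\<close>;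
      the factor 2 compensates, because \<open>q ^ 2 = 2 powr (-1/3)\<close> is at least
      1/2.\<close>
    have "real m \<le> 2 * sqrt x * q ^ k"
    proof (cases "k = 2")
      case True
      have "real m \<le> sqrt x" using mx True by (simp add: real_le_rsqrt)
      moreover have "1 \<le> 2 * q ^ k"
      proof -
        have "1 / 2 = 2 powr (- 1 :: real)" by (simp add: powr_minus)
        also have "\<dots> \<le> q ^ k" unfolding qk using True by (intro powr_mono) auto
        finally show ?thesis by simp
      qed
      moreover from this have "sqrt x * 1 \<le> sqrt x * (2 * q ^ k)"
        using sx by (intro mult_left_mono) auto
      ultimately show ?thesis by linarith
    next
      case False
      have "real m ^ 3 \<le> real m ^ k"
        using False k m1 by (intro power_increasing) auto
      then have "real m ^ 3 \<le> x" using mx by simp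
      then have "(real m ^ 3) powr (1 / 3) \<le> x powr (1 / 3)"
        by (intro powr_mono2) auto
      moreover have "(real m ^ 3) powr (1 / 3) = real m"
        using m1 powr_powr[of "real m" 3 "1 / 3"] by simp
      moreover have "x powr (1 / 3) = sqrt x * x powr (- 1 / 6)"
        using x by (simp add: powr_half_sqrt[symmetric] powr_add[symmetric])
      moreover have "sqrt x * x powr (- 1 / 6) \<le> sqrt x * q ^ k"
      proof -
        have "2 ^ k \<le> N" using \<open>\<not> N < 2 ^ k\<close> by simp
        then have "2 ^ k \<le> x"
          using x by (metis of_nat_le_iff of_nat_numeral of_nat_power order_trans)
        then have "x powr (- 1 / 6) \<le> (2 ^ k) powr (- 1 / 6)"
          by (intro powr_mono2') auto
        also have "\<dots> = q ^ k"
          unfolding qk by (subst powr_realpow[symmetric]) (simp_all add: powr_powr)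
        finally have "x powr (- 1 / 6) \<le> q ^ k" .
        then show ?thesis using sx by (intro mult_left_mono) auto
      qed
      ultimately have "real m \<le> sqrt x * q ^ k" by linarith
      moreover have "0 \<le> sqrt x * q ^ k" using sx by (simp add: q_def)
      ultimately show ?thesis by simp
    qed
    moreover have "\<bar>real (card (high_exponents k N)) - x * (1 - 1 / zeta (real k))\<bar> \<le> 3 * real m + 3"
      by (rule high_exponents_density_root[OF k x(2,3) m])
    \<comment> \<open>As \<open>m \<ge> 1\<close>, the error \<open>3 * m + 3\<close> is at most
      \<open>6 * m\<close>, whence the constant 12.\<close>
    ultimately show ?thesis using m1 by simp
  qed
qed

section \<open>The series for \<open>B2\<close>\<close>

definition zeta_coeff :: "nat \<Rightarrow> real" where
  "zeta_coeff j = (2 * real j + 3) * (1 - 1 / zeta (real (j + 2)))"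

lemma zeta_coeff_le: "zeta_coeff j \<le> (2 * real j + 3) / 2 ^ j"
  using mult_left_mono[OF one_minus_inverse_zeta(2)[of "j + 2"], of "2 * real j + 3"]
  by (simp add: zeta_coeff_def)

lemma zeta_coeff_nonneg: "0 \<le> zeta_coeff j"
  unfolding zeta_coeff_def using one_minus_inverse_zeta(1)[of "j + 2"] by (intro mult_nonneg_nonneg) auto

lemma summable_linear_geometric:
  fixes q :: real
  assumes "0 \<le> q" "q < 1"
  shows "summable (\<lambda>j. (2 * real j + 3) * q ^ j)"
proof (rule summable_comparison_test'[of _ 0])
  show "summable (\<lambda>j. 3 * (of_nat (Suc j) * q ^ j))"
    using assms by (intro summable_mult sums_summable[OF geometric_deriv_sums]) simp
  show "norm ((2 * real j + 3) * q ^ j) \<le> 3 * (of_nat (Suc j) * q ^ j)" for j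
    using assms by (simp add: abs_mult mult_right_mono flip: mult.assoc)
qed

lemma summable_zeta_coeff: "summable zeta_coeff"
proof (rule summable_comparison_test'[of _ 0])
  show "summable (\<lambda>j. (2 * real j + 3) * (1 / 2) ^ j)"
    by (rule summable_linear_geometric) auto
  show "norm (zeta_coeff j) \<le> (2 * real j + 3) * (1 / 2) ^ j" for j
    using zeta_coeff_le[of j] zeta_coeff_nonneg[of j] by (simp add: power_divide)
qed

lemma summable_zeta_series:
  shows "summable (\<lambda>k. 1 - 1 / zeta (real (k + 2)))"
    and "summable (\<lambda>k. (real (k + 2) - 1) * (1 - 1 / zeta (real (k + 2))))"
proof -
  note c = one_minus_inverse_zeta(1)[of "j + 2" for j]
  show "summable (\<lambda>k. 1 - 1 / zeta (real (k + 2)))"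
  proof (rule summable_comparison_test'[OF summable_zeta_coeff, of 0])
    show "norm (1 - 1 / zeta (real (k + 2))) \<le> zeta_coeff k" for k
      using c[of k] mult_right_mono[of 1 "2 * real k + 3", OF _ c[of k]] by (simp add: zeta_coeff_def)
  qed
  show "summable (\<lambda>k. (real (k + 2) - 1) * (1 - 1 / zeta (real (k + 2))))"
  proof (rule summable_comparison_test'[OF summable_zeta_coeff, of 0])
    show "norm ((real (k + 2) - 1) * (1 - 1 / zeta (real (k + 2)))) \<le> zeta_coeff k" for k
      using c[of k] mult_right_mono[of "real k + 1" "2 * real k + 3", OF _ c[of k]]
      by (simp add: zeta_coeff_def abs_mult add.commute)
  qed
qed

text \<open>The weights 1 from \<open>B1\<close> and \<open>2 * (k - 1)\<close> from the second
  series merge into \<open>2 * k - 1\<close>.\<close>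

lemma B2_eq: "B2 = 1 + suminf zeta_coeff"
proof -
  have "suminf zeta_coeff = (\<Sum>k. (1 - 1 / zeta (real (k + 2))) + 2 * ((real (k + 2) - 1) * (1 - 1 / zeta (real (k + 2)))))"
    by (rule suminf_cong) (simp add: zeta_coeff_def algebra_simps diff_divide_distrib add_divide_distrib)
  also have "\<dots> = (\<Sum>k. 1 - 1 / zeta (real (k + 2))) + 2 * (\<Sum>k. (real (k + 2) - 1) * (1 - 1 / zeta (real (k + 2))))"
    by (simp only: suminf_add[symmetric] suminf_mult summable_mult summable_zeta_series)
  finally show ?thesis by (simp only: B2_def B1_def add.assoc)
qed

text \<open>The majorant \<open>(2 * n + 3) / 2 ^ n\<close> is exactly the difference of consecutive
  values of \<open>(4 * n + 10) / 2 ^ n\<close>.\<close>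

lemma zeta_coeff_tail: "(\<Sum>j. zeta_coeff (j + J)) \<le> (4 * real J + 10) / 2 ^ J"
proof -
  define g where "g j = (4 * real (j + J) + 10) / 2 ^ (j + J)" for j
  have "(\<Sum>j. zeta_coeff (j + J)) \<le> g 0"
  proof (rule suminf_le_telescope)
    show "summable (\<lambda>j. zeta_coeff (j + J))"
      by (rule summable_ignore_initial_segment[OF summable_zeta_coeff])
    show "zeta_coeff (j + J) \<le> g j - g (Suc j)" for j
    proof -
      have "g j - g (Suc j) = (2 * real (j + J) + 3) / 2 ^ (j + J)"
        by (simp add: g_def field_simps)
      then show ?thesis using zeta_coeff_le[of "j + J"] by simp
    qed
    have "(\<lambda>n. (4 * real n + 10) / 2 ^ n) \<longlonglongrightarrow> 0" by real_asymp
    then show "g \<longlonglongrightarrow> 0" unfolding g_def[abs_def] by (rule LIMSEQ_ignore_initial_segment)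
  qed
  then show ?thesis by (simp add: g_def)
qed

section \<open>The asymptotic formula\<close>

lemma B2_asymptotics:
  "\<exists>C::real. \<forall>x::real. x > 2 \<longrightarrow>
     \<bar>(\<Sum>n | 1 \<le> n \<and> real n \<le> x. real (max_exponent n) ^ 2) - B2 * x\<bar> \<le> C * x powr (1 / 2)"
proof (intro exI allI impI)
  define q :: real where "q = 2 powr (- 1 / 6)"
  have q: "0 < q" "q < 1"
    unfolding q_def using powr_less_mono[of "- 1 / 6" 0 2] by auto
  \<comment> \<open>The weighted density error for the exponent \<open>j + 2\<close>, divided by
    \<open>sqrt x\<close>. It does not involve \<open>x\<close>, so its sum can enter the final
    constant.\<close>
  define W where "W j = 12 * q ^ 2 * ((2 * real j + 3) * q ^ j)" for j
  have W: "summable W"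
    unfolding W_def using q by (intro summable_mult summable_linear_geometric) auto
  fix x :: real assume "2 < x"
  define N where "N = nat \<lfloor>x\<rfloor>"
  have x: "1 \<le> x" "real N \<le> x" "x < real N + 1" using \<open>2 < x\<close> by (simp_all add: N_def) 
  have sx: "1 \<le> sqrt x" using x by simp
  define A where "A j = (2 * real j + 3) * real (card (high_exponents (j + 2) N))" for j
  \<comment> \<open>The finite layer sum thereby becomes an infinite series and can be compared
    termwise with that of \<open>zeta_coeff\<close>.\<close>
  have A0: "A j = 0" if "N \<le> j" for j
  proof -
    have "\<not> j + 2 \<le> max_exponent n" if "n \<in> {1..N}" for n
      using max_exponent_le[of n] that \<open>N \<le> j\<close> by simp
    then have "high_exponents (j + 2) N = {}" by (auto simp: high_exponents_def)
    then show ?thesis by (simp add: A_def)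
  qed
  have AE: "norm (A j - x * zeta_coeff j) \<le> sqrt x * W j" for j
  proof -
    have "A j - x * zeta_coeff j =
        (2 * real j + 3) * (real (card (high_exponents (j + 2) N)) - x * (1 - 1 / zeta (real (j + 2))))"
      by (simp add: A_def zeta_coeff_def right_diff_distrib mult.left_commute)
    also have "norm \<dots> \<le> (2 * real j + 3) * (12 * sqrt x * q ^ (j + 2))"
      unfolding real_norm_def abs_mult q_def by (intro mult_mono high_exponents_density x) auto
    also have "\<dots> = sqrt x * W j"
      by (simp add: W_def power_add power2_eq_square algebra_simps)
    finally show ?thesis .
  qed
  have A_sums: "A sums (\<Sum>j<N. A j)"
    by (rule sums_finite) (use A0 in auto)
  have E_sums: "(\<lambda>j. A j - x * zeta_coeff j) sums ((\<Sum>j<N. A j) - x * suminf zeta_coeff)"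
    by (intro sums_diff A_sums sums_mult summable_sums summable_zeta_coeff)
  have norm_summable: "summable (\<lambda>j. norm (A j - x * zeta_coeff j))"
    by (rule summable_comparison_test'[OF summable_mult[OF W, of "sqrt x"], of 0])
      (use AE in simp)
  have "\<bar>(\<Sum>j<N. A j) - x * suminf zeta_coeff\<bar> \<le> (\<Sum>j. norm (A j - x * zeta_coeff j))"
    using summable_norm[OF norm_summable] by (simp add: sums_unique[OF E_sums])
  also have "\<dots> \<le> (\<Sum>j. sqrt x * W j)"
    by (intro suminf_le summable_mult W norm_summable AE)
  also have "\<dots> = sqrt x * suminf W"
    by (rule suminf_mult[OF W])
  finally have main: "\<bar>(\<Sum>j<N. A j) - x * suminf zeta_coeff\<bar> \<le> sqrt x * suminf W" .
  have "{n. 1 \<le> n \<and> real n \<le> x} = {1..N}"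
  proof -
    have "real n \<le> x \<longleftrightarrow> n \<le> N" for n using x by linarith
    then show ?thesis by (simp only: atLeastAtMost_def atLeast_def atMost_def Collect_conj_eq)
  qed
  then have "(\<Sum>n | 1 \<le> n \<and> real n \<le> x. real (max_exponent n) ^ 2) = real N + (\<Sum>j<N. A j)"
    using sum_max_exponent_square[of N N] by (simp add: A_def)
  then have "(\<Sum>n | 1 \<le> n \<and> real n \<le> x. real (max_exponent n) ^ 2) - B2 * x
      = (real N - x) + ((\<Sum>j<N. A j) - x * suminf zeta_coeff)"
    by (simp add: B2_eq algebra_simps)
  \<comment> \<open>The 1 accounts for replacing \<open>x\<close> by its integer part in the leading
    term.\<close>
  then have "\<bar>(\<Sum>n | 1 \<le> n \<and> real n \<le> x. real (max_exponent n) ^ 2) - B2 * x\<bar> \<le> 1 + sqrt x * suminf W"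
    using main x by linarith
  also have "\<dots> \<le> (1 + suminf W) * sqrt x"
    using sx by (simp add: algebra_simps)
  finally show "\<bar>(\<Sum>n | 1 \<le> n \<and> real n \<le> x. real (max_exponent n) ^ 2) - B2 * x\<bar> \<le> (1 + suminf W) * x powr (1 / 2)"
    using x by (simp add: powr_half_sqrt)
qed

section \<open>The numerical value\<close>

text \<open>The cutoffs \<open>3 + 100 div (j + 1)\<close> make all truncation and rounding errors together smaller
  than \<open>10 ^ - 10\<close>, which the distance of \<open>B2\<close> from the ends of the target interval permits.\<close>

definition upper_term :: "nat \<Rightarrow> int" where
  "upper_term j = (2 * int j + 3) * coeff_upper (10 ^ 15) (3 + 100 div (j + 1)) (j + 2)"

definition lower_term :: "nat \<Rightarrow> int" where
  "lower_term j = (2 * int j + 3) * coeff_lower (10 ^ 15) (3 + 100 div (j + 1)) (j + 2)"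

text \<open>The 44 terms cover the exponents 2 to 45. In units of \<open>1 / 10 ^ 15\<close>, the
  bound leaves \<open>1 / 10 ^ 10\<close> for the remaining series below the upper end of the target
  interval.\<close>

lemma upper_sum:
  "sum_list (map upper_term [0..<44]) \<le> 3301302400400000"
  by code_simp

lemma lower_sum:
  "3301302400200000 \<le> sum_list (map lower_term [0..<44])"
  by code_simp

lemma sum_zeta_coeff_bounds:
  "10 ^ 15 * (\<Sum>j<J. zeta_coeff j) \<le> real_of_int (sum_list (map upper_term [0..<J]))"
  "real_of_int (sum_list (map lower_term [0..<J])) \<le> 10 ^ 15 * (\<Sum>j<J. zeta_coeff j)"
proof -
  have l: "sum_list (map t [0..<J]) = (\<Sum>j<J. t j)" for t :: "nat \<Rightarrow> int"
    by (simp add: interv_sum_list_conv_sum_set_nat atLeast0LessThan)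
  have b: "10 ^ 15 * zeta_coeff j \<le> real_of_int (upper_term j)" "real_of_int (lower_term j) \<le> 10 ^ 15 * zeta_coeff j" for j
    using mult_left_mono[OF coeff_bounds(1)[of "j + 2" "3 + 100 div (j + 1)" "10 ^ 15"], of "2 * real j + 3"]
      mult_left_mono[OF coeff_bounds(2)[of "j + 2" "3 + 100 div (j + 1)" "10 ^ 15"], of "2 * real j + 3"]
    by (simp_all add: upper_term_def lower_term_def zeta_coeff_def mult.left_commute)
  show "10 ^ 15 * (\<Sum>j<J. zeta_coeff j) \<le> real_of_int (sum_list (map upper_term [0..<J]))"
    "real_of_int (sum_list (map lower_term [0..<J])) \<le> 10 ^ 15 * (\<Sum>j<J. zeta_coeff j)"
    unfolding l of_int_sum sum_distrib_left by (intro sum_mono b)+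
qed

text \<open>The tolerance is half a unit in the ninth decimal place, the last one stated.\<close>

lemma B2_numeric: "\<bar>B2 - 4.301302400\<bar> < 5 / 10 ^ 10"
proof -
  have split: "suminf zeta_coeff = (\<Sum>j. zeta_coeff (j + 44)) + (\<Sum>j<44. zeta_coeff j)"
    by (rule suminf_split_initial_segment[OF summable_zeta_coeff])
  have "0 \<le> (\<Sum>j. zeta_coeff (j + 44))"
    by (intro suminf_nonneg summable_ignore_initial_segment summable_zeta_coeff zeta_coeff_nonneg)
  \<comment> \<open>The tail bound at 44 is \<open>186 / 2 ^ 44\<close>, about
    \<open>1.06 / 10 ^ 11\<close>.\<close>
  moreover have "(\<Sum>j. zeta_coeff (j + 44)) \<le> 2 / 10 ^ 11"
    using zeta_coeff_tail[of 44] by simp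
  moreover have "10 ^ 15 * (\<Sum>j<44. zeta_coeff j) \<le> 3301302400400000"
    by (rule order_trans[OF sum_zeta_coeff_bounds(1)]) (use upper_sum in linarith)
  moreover have "3301302400200000 \<le> 10 ^ 15 * (\<Sum>j<44. zeta_coeff j)"
    by (rule order_trans[OF _ sum_zeta_coeff_bounds(2)]) (use lower_sum in linarith)
  ultimately show ?thesis
    unfolding B2_eq split by simp
qed

theorem theorem1p3:
  shows "(\<exists>C::real. \<forall>x::real. x > 2 \<longrightarrow>
            \<bar>(\<Sum>n | 1 \<le> n \<and> real n \<le> x. real (max_exponent n) ^ 2) - B2 * x\<bar> \<le> C * x powr (1 / 2))
       \<and> summable (\<lambda>k. 1 - 1 / zeta (real (k + 2)))
       \<and> summable (\<lambda>k. (real (k + 2) - 1) * (1 - 1 / zeta (real (k + 2))))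
       \<and> \<bar>B2 - 4.301302400\<bar> < 5 / 10 ^ 10"
  using B2_asymptotics summable_zeta_series B2_numeric by blast

end
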